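(* Let $M,N\ge1$ be integers, let $\mathbf h\in\mathbb C^{M}$ and $\mathbf g\in\mathbb C^{N}$ be nonzero vectors, let $P_s,\sigma_r^2,\sigma_d^2>0$ and $0<\eta\le1$. Put $\gamma_1=P_s\|\mathbf h\|^2/\sigma_r^2$ and $C=\dfrac{(1+\gamma_1)\sigma_d^2}{2\eta P_s\|\mathbf h\|^2\|\mathbf g\|^2}$. Consider the problem (P2) $$\max_{0\le\alpha\le1}\ R(\alpha):=\frac{1-\alpha}{2}\log_2\left(1+\frac{\gamma_1}{1+\frac{C(1-\alpha)}{\alpha}}\right).$$ Define $$f(z)=\gamma_1Cz\ln z+(C-1)z^2-z(\gamma_1C+2C-2\gamma_1-2)-(\gamma_1+1)(\gamma_1+1-C).$$ Then $f$ is monotonically increasing on $(1,1+\gamma_1)$, with $f(1)=-\gamma_1^2$ and $f(1+\gamma_1)=\gamma_1C(1+\gamma_1)\ln(1+\gamma_1)$; the equation $f(z)=0$ has a unique solution $z^\star$ in the interval $(1,1+\gamma_1)$; and the optimal solution of (P2) is $$\alpha^\star=\frac{(z^\star-1)C}{(z^\star-1)C+1+\gamma_1-z^\star}.$$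
   Context: $\|\cdot\|$ is the Euclidean norm. At $\alpha=0$ the objective is understood by continuity, i.e. $R(0)=0$. In the underlying time-switching relaying model, $\alpha$ is the fraction of the block used for energy transfer, $\mathbf h$ and $\mathbf g$ are the source-to-relay and relay-to-destination channels, $P_s$ is the source power, $\sigma_r^2,\sigma_d^2$ are noise powers and $\eta$ is the energy harvesting efficiency; $R(\alpha)$ is the end-to-end throughput. *)

theory Defs
  imports "HOL-Analysis.Analysis"
begin

(* End-to-end throughput with time-switching fraction \<alpha>.  The value at \<alpha> = 0 is the limit for
   \<alpha> \<rightarrow> 0; it has to be set separately because x / 0 = 0 in HOL would give a nonzero value. *)
definition throughput :: "real \<Rightarrow> real \<Rightarrow> real \<Rightarrow> real" where
  "throughput \<gamma>1 C \<alpha> =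
     (if \<alpha> = 0 then 0
      else (1 - \<alpha>) / 2 * log 2 (1 + \<gamma>1 / (1 + C * (1 - \<alpha>) / \<alpha>)))"

definition stat_fun :: "real \<Rightarrow> real \<Rightarrow> real \<Rightarrow> real" where
  "stat_fun \<gamma>1 C z =
     \<gamma>1 * C * z * ln z + (C - 1) * z\<^sup>2 - z * (\<gamma>1 * C + 2 * C - 2 * \<gamma>1 - 2)
       - (\<gamma>1 + 1) * (\<gamma>1 + 1 - C)"

end

theory Submission
  imports Defs
begin

text \<open>
  Substitute z = 1 + \<gamma>1 / (1 + C (1 - \<alpha>) / \<alpha>), which maps the interval [0, 1] bijectively onto
  [1, 1 + \<gamma>1].  Up to the factor 1 / (2 ln 2) the throughput becomes
  \<phi>(z) = (1 + \<gamma>1 - z) ln z / D(z) with D(z) = (z - 1) C + 1 + \<gamma>1 - z, and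
  \<phi>'(z) = - f(z) / (z D(z)^2).  Since f increases strictly from a negative to a positive value,
  \<phi> increases strictly up to the zero of f and decreases strictly after it.
\<close>

definition snr_denom :: "real \<Rightarrow> real \<Rightarrow> real \<Rightarrow> real" where
  "snr_denom G C z = (z - 1) * C + 1 + G - z"

text \<open>The quotient (1 + G - z) / D(z) is 1 - \<alpha> written in terms of z.\<close>

definition rate_of_snr :: "real \<Rightarrow> real \<Rightarrow> real \<Rightarrow> real" where
  "rate_of_snr G C z = (1 + G - z) * ln z / snr_denom G C z"

text \<open>The inner fraction is cleared by \<alpha>, so that \<alpha> = 0 gives the limit value 1
  without a division by zero when C > 0.\<close>

definition snr_of_fraction :: "real \<Rightarrow> real \<Rightarrow> real \<Rightarrow> real" where
  "snr_of_fraction G C a = 1 + G * a / (a + C * (1 - a))"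

lemma stat_fun_1: "stat_fun G C 1 = - G\<^sup>2"
  by (simp add: stat_fun_def power2_eq_square algebra_simps)

lemma stat_fun_1_plus: "stat_fun G C (1 + G) = G * C * (1 + G) * ln (1 + G)"
  by (simp add: stat_fun_def power2_eq_square algebra_simps)

text \<open>The terms are grouped so that, for G, C > 0, each of the three is nonnegative on
  [1, 1 + G].\<close>

lemma has_real_derivative_stat_fun:
  assumes "z > 0"
  shows "(stat_fun G C has_real_derivative
           G * C * ln z + 2 * C * (z - 1) + 2 * (1 + G - z)) (at z)"
  unfolding stat_fun_def[abs_def] using assms
  by (auto intro!: derivative_eq_intros simp: field_simps power2_eq_square)

lemma continuous_on_stat_fun:
  assumes "\<And>z. z \<in> S \<Longrightarrow> z > 0"
  shows "continuous_on S (stat_fun G C)"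
  using has_real_derivative_stat_fun assms
  by (meson DERIV_isCont continuous_at_imp_continuous_on)

text \<open>(z - 1) C and 1 + G - z are nonnegative, with distinct zeros 1 and 1 + G.\<close>

lemma snr_denom_pos:
  assumes "G > 0" "C > 0" "1 \<le> z" "z \<le> 1 + G"
  shows "snr_denom G C z > 0"
proof (cases "z = 1")
  case False
  then have "(z - 1) * C > 0" using assms by simp
  then show ?thesis using assms by (simp add: snr_denom_def)
qed (use assms in \<open>simp add: snr_denom_def\<close>)

lemma has_real_derivative_rate_of_snr:
  assumes "z > 0" "snr_denom G C z \<noteq> 0"
  shows "(rate_of_snr G C has_real_derivative
           - stat_fun G C z / (z * (snr_denom G C z)\<^sup>2)) (at z)"
proof -
  have D: "(snr_denom G C has_real_derivative C - 1) (at z)"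
    unfolding snr_denom_def[abs_def] by (auto intro!: derivative_eq_intros)
  have N: "((\<lambda>z. (1 + G - z) * ln z) has_real_derivative (1 + G - z) / z - ln z) (at z)"
    using assms(1) by (auto intro!: derivative_eq_intros simp: field_simps)
  \<comment> \<open>This is z times the numerator of the quotient rule. The coefficient of ln z
    collapses, since D(z) + (1 + G - z) (C - 1) = G C, which leaves the term - G C z ln z of -
    f(z).\<close>
  have "z * (((1 + G - z) / z - ln z) * snr_denom G C z - (1 + G - z) * ln z * (C - 1))
      = (1 + G - z - z * ln z) * snr_denom G C z - z * ((1 + G - z) * ln z * (C - 1))"
    using assms(1) by (simp add: field_simps)
  also have "\<dots> = - stat_fun G C z"
    by (simp add: snr_denom_def stat_fun_def power2_eq_square algebra_simps)
  finally have eq: "- stat_fun G C z / z =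
      ((1 + G - z) / z - ln z) * snr_denom G C z - (1 + G - z) * ln z * (C - 1)"
    using assms(1) by (metis less_irrefl nonzero_mult_div_cancel_left)
  have "- stat_fun G C z / (z * (snr_denom G C z)\<^sup>2) = - stat_fun G C z / z /
      (snr_denom G C z * snr_denom G C z)"
    by (simp add: power2_eq_square)
  then show ?thesis
    using DERIV_divide[OF N D assms(2)] unfolding rate_of_snr_def[abs_def] eq by simp
qed

context
  fixes G C :: real
  assumes G: "G > 0" and C: "C > 0"
begin

lemma stat_fun_less:
  assumes "1 \<le> x" "x < y" "y \<le> 1 + G"
  shows "stat_fun G C x < stat_fun G C y"
proof (rule DERIV_pos_imp_increasing_open[OF assms(2)])
  fix z assume z: "x < z" "z < y"
  have "G * C * ln z \<ge> 0" "2 * C * (z - 1) \<ge> 0" using G C z assms by auto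
  \<comment> \<open>Strictness comes from the last summand, since z < y \<le> 1 + G.\<close>
  then have "G * C * ln z + 2 * C * (z - 1) + 2 * (1 + G - z) > 0"
    using z assms by (intro add_nonneg_pos add_nonneg_nonneg) auto
  then show "\<exists>d. (stat_fun G C has_real_derivative d) (at z) \<and> d > 0"
    using has_real_derivative_stat_fun[of z] z assms by (meson less_le_trans less_trans zero_less_one)
qed (use assms in \<open>auto intro: continuous_on_stat_fun\<close>)

lemma stat_fun_ex1_zero: "\<exists>!z. z \<in> {1<..<1 + G} \<and> stat_fun G C z = 0"
proof -
  have neg: "stat_fun G C 1 < 0" using G by (simp add: stat_fun_1)
  have pos: "stat_fun G C (1 + G) > 0" using G C by (simp add: stat_fun_1_plus)
  have "\<exists>z\<ge>1. z \<le> 1 + G \<and> stat_fun G C z = 0"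
    using neg pos G by (intro IVT') (auto intro: continuous_on_stat_fun)
  then obtain z where z: "1 \<le> z" "z \<le> 1 + G" "stat_fun G C z = 0" by blast
  then have "z \<noteq> 1" "z \<noteq> 1 + G" using neg pos by auto
  moreover have "x = y" if "x \<in> {1<..<1 + G}" "stat_fun G C x = 0"
    "y \<in> {1<..<1 + G}" "stat_fun G C y = 0" for x y
    using that stat_fun_less[of x y] stat_fun_less[of y x] by (cases x y rule: linorder_cases) auto
  ultimately show ?thesis using z by (intro ex_ex1I) (auto intro!: exI[of _ z])
qed

lemma rate_of_snr_less:
  assumes z: "1 < z" "z < 1 + G" "stat_fun G C z = 0"
    and x: "1 \<le> x" "x \<le> 1 + G" "x \<noteq> z"
  shows "rate_of_snr G C x < rate_of_snr G C z"
proof -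
  have deriv: "(rate_of_snr G C has_real_derivative
      - stat_fun G C y / (y * (snr_denom G C y)\<^sup>2)) (at y)" if "1 \<le> y" "y \<le> 1 + G" for y
    using that snr_denom_pos[OF G C, of y] by (intro has_real_derivative_rate_of_snr) auto
  have cont: "continuous_on {a..b} (rate_of_snr G C)" if "1 \<le> a" "b \<le> 1 + G" for a b
  proof (intro continuous_at_imp_continuous_on ballI)
    show "isCont (rate_of_snr G C) y" if "y \<in> {a..b}" for y
      using that \<open>1 \<le> a\<close> \<open>b \<le> 1 + G\<close> by (intro DERIV_isCont[OF deriv]) auto
  qed
  have den: "y * (snr_denom G C y)\<^sup>2 > 0" if "1 \<le> y" "y \<le> 1 + G" for y
    using that snr_denom_pos[OF G C, of y] by simp
  show ?thesis
  proof (cases "x < z")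
    case True
    show ?thesis
    proof (rule DERIV_pos_imp_increasing_open[OF True])
      fix y assume y: "x < y" "y < z"
      have "- stat_fun G C y / (y * (snr_denom G C y)\<^sup>2) > 0"
        using stat_fun_less[of y z] den[of y] x y z by (intro divide_pos_pos) auto
      then show "\<exists>d. (rate_of_snr G C has_real_derivative d) (at y) \<and> d > 0"
        using deriv[of y] x y z by fastforce
    qed (use cont x z in auto)
  next
    case False
    then have "z < x" using x by simp
    then show ?thesis
    proof (rule DERIV_neg_imp_decreasing_open)
      fix y assume y: "z < y" "y < x"
      have "- stat_fun G C y / (y * (snr_denom G C y)\<^sup>2) < 0"
        using stat_fun_less[of z y] den[of y] x y z by (intro divide_neg_pos) auto
      then show "\<exists>d. (rate_of_snr G C has_real_derivative d) (at y) \<and> d < 0"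
        using deriv[of y] x y z by fastforce
    qed (use cont x z in auto)
  qed
qed

lemma fraction_denom_pos:
  assumes "0 \<le> a" "a \<le> 1"
  shows "a + C * (1 - a) > 0"
  using assms C by (cases "a = 0") (auto intro: add_pos_nonneg)

lemma snr_of_fraction_bounds:
  assumes "0 \<le> a" "a \<le> 1"
  shows "1 \<le> snr_of_fraction G C a" "snr_of_fraction G C a \<le> 1 + G"
proof -
  \<comment> \<open>This product is G (a + C (1 - a)) - G a, so the added quotient is at most
    G.\<close>
  have "0 \<le> G * (C * (1 - a))" using assms G C by simp
  then show "1 \<le> snr_of_fraction G C a" "snr_of_fraction G C a \<le> 1 + G"
    using fraction_denom_pos[OF assms] assms G
    by (auto simp: snr_of_fraction_def divide_le_eq algebra_simps)
qed

text \<open>Clearing the denominator leaves an equation linear in a, whose leading coefficient is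
  D(z) > 0. This inverts the substitution and shows that it is injective.\<close>

lemma snr_of_fraction_eq_iff:
  assumes "0 \<le> a" "a \<le> 1" "1 \<le> z" "z \<le> 1 + G"
  shows "snr_of_fraction G C a = z \<longleftrightarrow> a = (z - 1) * C / ((z - 1) * C + 1 + G - z)"
proof -
  have "snr_of_fraction G C a = z \<longleftrightarrow> G * a / (a + C * (1 - a)) = z - 1"
    by (auto simp: snr_of_fraction_def)
  also have "\<dots> \<longleftrightarrow> G * a = (z - 1) * (a + C * (1 - a))"
    using fraction_denom_pos[OF assms(1,2)] by (simp add: nonzero_divide_eq_eq)
  also have "\<dots> \<longleftrightarrow> a * ((z - 1) * C + 1 + G - z) = (z - 1) * C"
    by (auto simp: algebra_simps)
  also have "\<dots> \<longleftrightarrow> a = (z - 1) * C / ((z - 1) * C + 1 + G - z)"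
    using snr_denom_pos[OF G C assms(3,4)] by (simp add: snr_denom_def nonzero_eq_divide_eq)
  finally show ?thesis .
qed

lemma throughput_eq_rate_of_snr:
  assumes "0 \<le> a" "a \<le> 1"
  shows "throughput G C a = rate_of_snr G C (snr_of_fraction G C a) / (2 * ln 2)"
proof (cases "a = 0")
  \<comment> \<open>Here z = 1, and ln 1 = 0 reproduces the value 0 set in
    \<open>throughput\<close>.\<close>
  case True
  then show ?thesis by (simp add: throughput_def rate_of_snr_def snr_of_fraction_def)
next
  case False
  define z where "z = snr_of_fraction G C a"
  have bounds: "1 \<le> z" "z \<le> 1 + G"
    using snr_of_fraction_bounds[OF assms] by (auto simp: z_def)
  have D: "snr_denom G C z > 0" by (rule snr_denom_pos[OF G C bounds])
  have a: "a = (z - 1) * C / snr_denom G C z"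
    using snr_of_fraction_eq_iff[OF assms bounds] by (simp add: z_def snr_denom_def)
  \<comment> \<open>D(z) minus the numerator (z - 1) C of a is 1 + G - z.\<close>
  have "1 - a = (1 + G - z) / snr_denom G C z"
    unfolding a using D by (simp add: field_simps) (simp add: snr_denom_def algebra_simps)
  moreover have "1 + G / (1 + C * (1 - a) / a) = z"
    using False fraction_denom_pos[OF assms] by (simp add: z_def snr_of_fraction_def add_divide_eq_iff)
  ultimately show ?thesis
    using False by (simp add: throughput_def rate_of_snr_def log_def flip: z_def)
qed

lemma is_arg_max_throughput_iff:
  assumes z: "1 < z" "z < 1 + G" "stat_fun G C z = 0"
  shows "is_arg_max (throughput G C) (\<lambda>a. 0 \<le> a \<and> a \<le> 1) a \<longleftrightarrow>
           a = (z - 1) * C / ((z - 1) * C + 1 + G - z)"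
proof -
  define s where "s = (z - 1) * C / ((z - 1) * C + 1 + G - z)"
  \<comment> \<open>The denominator exceeds the numerator by 1 + G - z > 0.\<close>
  have s: "0 \<le> s" "s \<le> 1"
    using z C snr_denom_pos[OF G C, of z] by (auto simp: s_def snr_denom_def)
  have snr_s: "snr_of_fraction G C s = z"
    using snr_of_fraction_eq_iff[OF s] z by (simp add: s_def)
  \<comment> \<open>The strict inequality yields both optimality and uniqueness: s is the only
    preimage of z, so any other b is sent to a point where the rate is strictly smaller.\<close>
  have less: "throughput G C b < throughput G C s" if b: "0 \<le> b" "b \<le> 1" "b \<noteq> s" for b
  proof -
    have "snr_of_fraction G C b \<noteq> z"
      using snr_of_fraction_eq_iff[OF b(1,2)] z b(3) by (simp add: s_def)
    then have "rate_of_snr G C (snr_of_fraction G C b) < rate_of_snr G C z"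
      using rate_of_snr_less[OF z] snr_of_fraction_bounds[OF b(1,2)] by blast
    then show ?thesis
      using b s by (simp add: throughput_eq_rate_of_snr snr_s divide_strict_right_mono)
  qed
  show ?thesis
    unfolding s_def[symmetric] is_arg_max_def using s less by (metis less_asym less_irrefl)
qed

end

text \<open>The last conjunct is an equivalence, so it asserts that the maximiser exists and is
  unique.\<close>

theorem theorem2:
  fixes h :: "complex ^ 'm" and g :: "complex ^ 'n"
    and Ps \<sigma>r \<sigma>d \<eta> \<gamma>1 C :: real
  assumes "h \<noteq> 0" and "g \<noteq> 0"
    and "Ps > 0" and "\<sigma>r\<^sup>2 > 0" and "\<sigma>d\<^sup>2 > 0"
    and "0 < \<eta>" and "\<eta> \<le> 1"
    and "\<gamma>1 = Ps * (norm h)\<^sup>2 / \<sigma>r\<^sup>2"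
    and "C = (1 + \<gamma>1) * \<sigma>d\<^sup>2 / (2 * \<eta> * Ps * (norm h)\<^sup>2 * (norm g)\<^sup>2)"
  shows "strict_mono_on {1<..<1 + \<gamma>1} (stat_fun \<gamma>1 C)
    \<and> stat_fun \<gamma>1 C 1 = - \<gamma>1\<^sup>2
    \<and> stat_fun \<gamma>1 C (1 + \<gamma>1) = \<gamma>1 * C * (1 + \<gamma>1) * ln (1 + \<gamma>1)
    \<and> (\<exists>!z. z \<in> {1<..<1 + \<gamma>1} \<and> stat_fun \<gamma>1 C z = 0)
    \<and> (\<forall>z\<in>{1<..<1 + \<gamma>1}. stat_fun \<gamma>1 C z = 0 \<longrightarrow>
         (\<forall>\<alpha>. is_arg_max (throughput \<gamma>1 C) (\<lambda>a. 0 \<le> a \<and> a \<le> 1) \<alpha> \<longleftrightarrow>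
              \<alpha> = (z - 1) * C / ((z - 1) * C + 1 + \<gamma>1 - z)))"
proof -
  have pos: "\<gamma>1 > 0" using assms by simp
  have "C > 0" using assms(1-7,9) pos by simp
  then show ?thesis
    using pos stat_fun_less[OF pos] stat_fun_1 stat_fun_1_plus stat_fun_ex1_zero[OF pos]
      is_arg_max_throughput_iff[OF pos]
    by (intro conjI) (auto simp: strict_mono_on_def)
qed

end
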